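(* Let $\Sigma=(\Gamma,\sigma)$ be a signed graph on $n$ vertices. Then \[ \lambda_{\max}(L(\Sigma))\ge \sqrt{\frac{s_1^2-s_2-s_1}{(n-b(\Sigma))(n-b(\Sigma)-1)}}\quad\text{if } b(\Sigma)\le n-2; \] \[ \lambda_{\max}(L(\Sigma))\ge \left(\frac{2s_3+6s_2-3s_2s_1+s_1^3-3s_1^2-12t^{\pm}(\Sigma)}{(n-b(\Sigma))(n-b(\Sigma)-1)(n-b(\Sigma)-2)}\right)^{1/3}\quad\text{if } b(\Sigma)\le n-3; \] \[ \lambda_{\max}(L(\Sigma))\ge \left(\frac{s_1^2-3s_2+s_1s_2-s_3+6t^{\pm}(\Sigma)}{(n-b(\Sigma))(n-b(\Sigma)-1)}\right)^{1/3}\quad\text{if } b(\Sigma)\le n-2. \]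
   Context: A signed graph $\Sigma=(\Gamma,\sigma)$ consists of a simple graph $\Gamma=(V,E)$, $V=\{v_1,\dots,v_n\}$, and a signature $\sigma:E\to\{+1,-1\}$. The adjacency matrix $A(\Sigma)$ has $(i,j)$ entry $\sigma(v_iv_j)$ if $v_i,v_j$ are adjacent and $0$ otherwise; $D(\Sigma)$ is the diagonal matrix of degrees $d_j=\deg(v_j)$; the Laplacian is $L(\Sigma)=D(\Sigma)-A(\Sigma)$ and $\lambda_{\max}(L(\Sigma))$ its largest eigenvalue. $s_p=\sum_{j=1}^n d_j^p$. The sign of a cycle is the product of the signs of its edges; $\Sigma$ is balanced if all its cycles are positive; $b(\Sigma)$ is the number of balanced connected components of $\Sigma$. $t^+(\Sigma)$ and $t^-(\Sigma)$ are the numbers of triangles of $\Sigma$ with positive and negative sign respectively, and $t^{\pm}(\Sigma)=t^+(\Sigma)-t^-(\Sigma)$. *)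

theory Defs
  imports
    "Graph_Theory.Graph_Theory"
    "Jordan_Normal_Form.Spectral_Radius"
begin

text \<open>
  A finite simple graph is an instance of the locale \<^locale>\<open>graph\<close>: a finite symmetric digraph
  without loops and without parallel arcs, in which an edge \<open>uv\<close> is represented by the two arcs
  from \<open>u\<close> to \<open>v\<close> and from \<open>v\<close> to \<open>u\<close>. The signature is a function of the unordered edge
  \<open>{u, v}\<close>; its values on sets that are not edges are irrelevant.
\<close>

locale signed_graph = graph G for G :: "('a, 'b) pre_digraph" +
  fixes \<sigma> :: "'a set \<Rightarrow> real"
  assumes signature: "u \<rightarrow>\<^bsub>G\<^esub> v \<Longrightarrow> \<sigma> {u, v} = 1 \<or> \<sigma> {u, v} = -1"

text \<open>Since every edge is a pair of opposite arcs, the degree of a vertex is its out-degree.\<close>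

definition degree_power_sum :: "('a, 'b) pre_digraph \<Rightarrow> nat \<Rightarrow> real" where
  "degree_power_sum G p = (\<Sum>v\<in>verts G. real (out_degree G v) ^ p)"

text \<open>
  The matrices are taken with respect to an enumeration \<open>vs\<close> of the vertices (a distinct list with
  \<open>set vs = verts G\<close>).
\<close>

definition adjacency_matrix :: "('a, 'b) pre_digraph \<Rightarrow> ('a set \<Rightarrow> real) \<Rightarrow> 'a list \<Rightarrow> real mat" where
  "adjacency_matrix G \<sigma> vs = mat (length vs) (length vs)
     (\<lambda>(i, j). if vs ! i \<rightarrow>\<^bsub>G\<^esub> vs ! j then \<sigma> {vs ! i, vs ! j} else 0)"

definition degree_matrix :: "('a, 'b) pre_digraph \<Rightarrow> 'a list \<Rightarrow> real mat" where
  "degree_matrix G vs = mat (length vs) (length vs)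
     (\<lambda>(i, j). if i = j then real (out_degree G (vs ! i)) else 0)"

definition laplacian :: "('a, 'b) pre_digraph \<Rightarrow> ('a set \<Rightarrow> real) \<Rightarrow> 'a list \<Rightarrow> real mat" where
  "laplacian G \<sigma> vs = degree_matrix G vs - adjacency_matrix G \<sigma> vs"

text \<open>
  Meaningful for nonempty symmetric real matrices, whose spectrum is finite and nonempty and whose
  complex eigenvalues are all real.
\<close>

definition largest_eigenvalue :: "real mat \<Rightarrow> real" where
  "largest_eigenvalue A = Max (spectrum A)"

definition cycle_sign :: "('a, 'b) pre_digraph \<Rightarrow> ('a set \<Rightarrow> real) \<Rightarrow> 'b awalk \<Rightarrow> real" where
  "cycle_sign G \<sigma> p = (\<Prod>e\<leftarrow>p. \<sigma> {tail G e, head G e})"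

text \<open>
  A closed walk \<open>u, v, u\<close> is a cycle of the symmetric digraph but not of the underlying undirected
  graph, hence the restriction to length at least three.
\<close>

definition balanced :: "('a, 'b) pre_digraph \<Rightarrow> ('a set \<Rightarrow> real) \<Rightarrow> bool" where
  "balanced G \<sigma> \<longleftrightarrow> (\<forall>p. pre_digraph.cycle G p \<and> 3 \<le> length p \<longrightarrow> cycle_sign G \<sigma> p = 1)"

text \<open>
  In a symmetric digraph the strongly connected components are the connected components of the
  underlying undirected graph.
\<close>

definition num_balanced_components :: "('a, 'b) pre_digraph \<Rightarrow> ('a set \<Rightarrow> real) \<Rightarrow> nat" where
  "num_balanced_components G \<sigma> = card {H \<in> pre_digraph.sccs G. balanced H \<sigma>}"

text \<open>A triangle is given by its set of three vertices.\<close>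

definition triangles :: "('a, 'b) pre_digraph \<Rightarrow> 'a set set" where
  "triangles G = {T. T \<subseteq> verts G \<and> card T = 3 \<and> (\<forall>u\<in>T. \<forall>v\<in>T. u \<noteq> v \<longrightarrow> u \<rightarrow>\<^bsub>G\<^esub> v)}"

definition triangle_sign :: "('a set \<Rightarrow> real) \<Rightarrow> 'a set \<Rightarrow> real" where
  "triangle_sign \<sigma> T = (\<Prod>e\<in>{e. e \<subseteq> T \<and> card e = 2}. \<sigma> e)"

definition num_positive_triangles :: "('a, 'b) pre_digraph \<Rightarrow> ('a set \<Rightarrow> real) \<Rightarrow> nat" where
  "num_positive_triangles G \<sigma> = card {T \<in> triangles G. triangle_sign \<sigma> T = 1}"

definition num_negative_triangles :: "('a, 'b) pre_digraph \<Rightarrow> ('a set \<Rightarrow> real) \<Rightarrow> nat" where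
  "num_negative_triangles G \<sigma> = card {T \<in> triangles G. triangle_sign \<sigma> T = -1}"

definition net_triangles :: "('a, 'b) pre_digraph \<Rightarrow> ('a set \<Rightarrow> real) \<Rightarrow> real" where
  "net_triangles G \<sigma> = real (num_positive_triangles G \<sigma>) - real (num_negative_triangles G \<sigma>)"

end

theory Submission
  imports Defs
begin

text \<open>
  The Laplacian is symmetric and positive semidefinite, so its eigenvalues lie in the interval from
  \<open>0\<close> to \<open>\<lambda>\<^sub>m\<^sub>a\<^sub>x\<close>. On a balanced component the signature is a coboundary,
  \<open>\<sigma> {u, v} = \<theta> u * \<theta> v\<close>, and \<open>\<theta>\<close> extended by \<open>0\<close> is in the kernel; hence at most
  \<open>m = n - b\<close> eigenvalues are nonzero. Counting closed walks of length at most three expresses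
  the power sums \<open>p\<^sub>1, p\<^sub>2, p\<^sub>3\<close> of these \<open>m\<close> eigenvalues by degrees and triangles. The numerators of the
  three bounds are \<open>p\<^sub>1\<^sup>2 - p\<^sub>2\<close>, \<open>p\<^sub>1\<^sup>3 - 3 p\<^sub>1 p\<^sub>2 + 2 p\<^sub>3\<close> and \<open>p\<^sub>1 p\<^sub>2 - p\<^sub>3\<close>, which are sums
  of \<open>m (m - 1)\<close>, \<open>m (m - 1) (m - 2)\<close> and \<open>m (m - 1)\<close> monomials in the eigenvalues.
\<close>

section \<open>Power sums and traces\<close>

text \<open>Induction on the list avoids sums over tuples of distinct indices. Prepending
  \<open>x\<close> adds \<open>2 * (x * P1)\<close>, \<open>3 * (x * (P1\<^sup>2 - P2))\<close> and
  \<open>x\<^sup>2 * P1 + x * P2\<close> to the three left-hand sides.\<close>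

lemma power_sums_le:
  fixes xs :: "real list"
  assumes "\<And>x. x \<in> set xs \<Longrightarrow> 0 \<le> x \<and> x \<le> M" and "0 \<le> M"
  defines "p \<equiv> \<lambda>k. \<Sum>x\<leftarrow>xs. x ^ k" and "m \<equiv> real (length xs)"
  shows "(p 1)\<^sup>2 - p 2 \<le> m * (m - 1) * M\<^sup>2"
    and "(p 1)^3 - 3 * p 1 * p 2 + 2 * p 3 \<le> m * (m - 1) * (m - 2) * M^3"
    and "p 1 * p 2 - p 3 \<le> m * (m - 1) * M^3"
proof -
  \<comment> \<open>The bounds on \<open>p 1\<close> and \<open>p 2\<close> strengthen the
    induction: they control the terms \<open>x * P1\<close>, \<open>x\<^sup>2 * P1\<close> and
    \<open>x * P2\<close>.\<close>
  have "p 1 \<le> m * M \<and> p 2 \<le> m * M\<^sup>2 \<and> (p 1)\<^sup>2 - p 2 \<le> m * (m - 1) * M\<^sup>2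
    \<and> (p 1)^3 - 3 * p 1 * p 2 + 2 * p 3 \<le> m * (m - 1) * (m - 2) * M^3
    \<and> p 1 * p 2 - p 3 \<le> m * (m - 1) * M^3"
    using assms(1) unfolding p_def m_def
  proof (induction xs)
    case (Cons x xs)
    define P1 P2 P3 k where "P1 = (\<Sum>x\<leftarrow>xs. x ^ 1)" and "P2 = (\<Sum>x\<leftarrow>xs. x ^ 2)"
      and "P3 = (\<Sum>x\<leftarrow>xs. x ^ 3)" and "k = real (length xs)"
    have x: "0 \<le> x" "x \<le> M" using Cons.prems by auto
    have IH: "P1 \<le> k * M" "P2 \<le> k * M\<^sup>2" "P1\<^sup>2 - P2 \<le> k * (k - 1) * M\<^sup>2"
      "P1^3 - 3 * P1 * P2 + 2 * P3 \<le> k * (k - 1) * (k - 2) * M^3"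
      "P1 * P2 - P3 \<le> k * (k - 1) * M^3"
      using Cons unfolding P1_def P2_def P3_def k_def by auto
    \<comment> \<open>Replacing the factor \<open>x\<close> by \<open>M\<close> in front of an upper
      bound requires that bound to be nonnegative. For \<open>k = 0\<close> the factor
      \<open>k - 1\<close> is negative, but the product is not.\<close>
    have k: "0 \<le> k" "0 \<le> k * (k - 1)"
      unfolding k_def by (cases "length xs", auto)+
    have x2: "x\<^sup>2 \<le> M\<^sup>2" using x by (intro power_mono) auto
    have a: "x * P1 \<le> M * (k * M)"
      using x IH(1) k(1) \<open>0 \<le> M\<close> by (meson mult_left_mono mult_right_mono mult_nonneg_nonneg order_trans)
    have b: "x * (P1\<^sup>2 - P2) \<le> M * (k * (k - 1) * M\<^sup>2)"
      using x IH(3) k(2) \<open>0 \<le> M\<close>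
      by (meson mult_left_mono mult_right_mono mult_nonneg_nonneg order_trans zero_le_power)
    have c: "x\<^sup>2 * P1 \<le> M\<^sup>2 * (k * M)"
      using x2 IH(1) k(1) \<open>0 \<le> M\<close>
      by (meson mult_left_mono mult_right_mono mult_nonneg_nonneg order_trans zero_le_power2)
    have d: "x * P2 \<le> M * (k * M\<^sup>2)"
      using x IH(2) k(1) \<open>0 \<le> M\<close>
      by (meson mult_left_mono mult_right_mono mult_nonneg_nonneg order_trans zero_le_power2)
    have m: "real (length (x # xs)) = k + 1" by (simp add: k_def)
    have P: "(\<Sum>x\<leftarrow>x # xs. x ^ 1) = x + P1" "(\<Sum>x\<leftarrow>x # xs. x ^ 2) = x\<^sup>2 + P2"
      "(\<Sum>x\<leftarrow>x # xs. x ^ 3) = x ^ 3 + P3"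
      by (simp_all add: P1_def P2_def P3_def)
    have e1: "x + P1 \<le> (k + 1) * M" "x\<^sup>2 + P2 \<le> (k + 1) * M\<^sup>2"
      unfolding distrib_right using x(2) x2 IH(1,2) by linarith+
    have e2: "(x + P1)\<^sup>2 - (x\<^sup>2 + P2) \<le> (k + 1) * (k + 1 - 1) * M\<^sup>2"
    proof -
      have "(x + P1)\<^sup>2 - (x\<^sup>2 + P2) = (P1\<^sup>2 - P2) + 2 * (x * P1)"
        by (simp add: power2_eq_square algebra_simps)
      also have "\<dots> \<le> k * (k - 1) * M\<^sup>2 + 2 * (M * (k * M))" using IH(3) a by simp
      also have "\<dots> = (k + 1) * (k + 1 - 1) * M\<^sup>2" by (simp add: power2_eq_square algebra_simps)
      finally show ?thesis .
    qed
    have e3: "(x + P1)^3 - 3 * (x + P1) * (x\<^sup>2 + P2) + 2 * (x ^ 3 + P3)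
        \<le> (k + 1) * (k + 1 - 1) * (k + 1 - 2) * M^3"
    proof -
      have "(x + P1)^3 - 3 * (x + P1) * (x\<^sup>2 + P2) + 2 * (x ^ 3 + P3)
          = (P1^3 - 3 * P1 * P2 + 2 * P3) + 3 * (x * (P1\<^sup>2 - P2))"
        by (simp add: power2_eq_square power3_eq_cube algebra_simps)
      also have "\<dots> \<le> k * (k - 1) * (k - 2) * M^3 + 3 * (M * (k * (k - 1) * M\<^sup>2))" using IH(4) b by simp
      also have "\<dots> = (k + 1) * (k + 1 - 1) * (k + 1 - 2) * M^3"
        by (simp add: power2_eq_square power3_eq_cube algebra_simps)
      finally show ?thesis .
    qed
    have e4: "(x + P1) * (x\<^sup>2 + P2) - (x ^ 3 + P3) \<le> (k + 1) * (k + 1 - 1) * M^3"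
    proof -
      have "(x + P1) * (x\<^sup>2 + P2) - (x ^ 3 + P3) = (P1 * P2 - P3) + x\<^sup>2 * P1 + x * P2"
        by (simp add: power2_eq_square power3_eq_cube algebra_simps)
      also have "\<dots> \<le> k * (k - 1) * M^3 + M\<^sup>2 * (k * M) + M * (k * M\<^sup>2)" using IH(5) c d by linarith
      also have "\<dots> = (k + 1) * (k + 1 - 1) * M^3"
        by (simp add: power2_eq_square power3_eq_cube algebra_simps)
      finally show ?thesis .
    qed
    show ?case unfolding m P using e1 e2 e3 e4 by blast
  qed auto
  then show "(p 1)\<^sup>2 - p 2 \<le> m * (m - 1) * M\<^sup>2"
    and "(p 1)^3 - 3 * p 1 * p 2 + 2 * p 3 \<le> m * (m - 1) * (m - 2) * M^3"
    and "p 1 * p 2 - p 3 \<le> m * (m - 1) * M^3" by auto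
qed

section \<open>Traces of powers as power sums of eigenvalues\<close>

definition mat_trace :: "'a :: comm_monoid_add mat \<Rightarrow> 'a" where
  "mat_trace A = (\<Sum>i<dim_row A. A $$ (i, i))"

lemma mat_trace_mult:
  assumes "A \<in> carrier_mat n m" and "B \<in> carrier_mat m n"
  shows "mat_trace (A * B) = (\<Sum>i<n. \<Sum>j<m. A $$ (i, j) * B $$ (j, i))"
  using assms by (auto simp: mat_trace_def scalar_prod_def atLeast0LessThan intro!: sum.cong)

lemma mat_trace_comm:
  fixes A :: "'a :: comm_semiring_0 mat"
  assumes "A \<in> carrier_mat n m" and "B \<in> carrier_mat m n"
  shows "mat_trace (A * B) = mat_trace (B * A)"
  unfolding mat_trace_mult[OF assms] mat_trace_mult[OF assms(2,1)]
  by (subst sum.swap) (simp add: mult.commute)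

lemma mat_trace_similar:
  fixes A :: "'a :: comm_ring_1 mat"
  assumes "A \<in> carrier_mat n n" and sim: "similar_mat_wit A B P Q"
  shows "mat_trace A = mat_trace B"
proof -
  note w = similar_mat_witD2[OF assms]
  have "mat_trace A = mat_trace (P * (B * Q))"
    using w by (simp add: assoc_mult_mat[of P n n B n Q n])
  also have "\<dots> = mat_trace (B * Q * P)" using w by (subst mat_trace_comm[of _ n n]) auto
  also have "B * Q * P = B" using w by (simp add: assoc_mult_mat[of B n n Q n P n])
  finally show ?thesis .
qed

lemma upper_triangular_mult_diag:
  fixes A :: "'a :: comm_semiring_1 mat"
  assumes A: "A \<in> carrier_mat n n" "upper_triangular A" and B: "B \<in> carrier_mat n n" "upper_triangular B"
  shows "upper_triangular (A * B)" and "i < n \<Longrightarrow> (A * B) $$ (i, i) = A $$ (i, i) * B $$ (i, i)"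
proof -
  \<comment> \<open>A nonzero term needs \<open>i \<le> k\<close> and \<open>k \<le> j\<close>; on
    or below the diagonal this forces \<open>k = i = j\<close>.\<close>
  have z: "A $$ (i, k) * B $$ (k, j) = 0" if "i < n" "k < n" "j \<le> i" "\<not> (k = i \<and> j = i)" for i j k
  proof (cases "k < i")
    case True
    with A that have "A $$ (i, k) = 0" by auto
    then show ?thesis by simp
  next
    case False
    with B that have "B $$ (k, j) = 0" by auto
    then show ?thesis by simp
  qed
  show "upper_triangular (A * B)"
  proof
    fix i j assume "j < i" "i < dim_row (A * B)"
    then show "(A * B) $$ (i, j) = 0" using A B z[of i _ j]
      by (auto simp: scalar_prod_def intro!: sum.neutral)
  qed
  assume i: "i < n"
  have "(A * B) $$ (i, i) = (\<Sum>k<n. A $$ (i, k) * B $$ (k, i))"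
    using A B i by (auto simp: scalar_prod_def atLeast0LessThan)
  also have "\<dots> = (\<Sum>k\<in>{i}. A $$ (i, k) * B $$ (k, i))"
    by (rule sum.mono_neutral_right) (use i z in auto)
  finally show "(A * B) $$ (i, i) = A $$ (i, i) * B $$ (i, i)" by simp
qed

lemma upper_triangular_pow:
  fixes A :: "'a :: comm_semiring_1 mat"
  assumes A: "A \<in> carrier_mat n n" "upper_triangular A"
  shows "upper_triangular (A ^\<^sub>m k) \<and> (\<forall>i<n. (A ^\<^sub>m k) $$ (i, i) = (A $$ (i, i)) ^ k)"
proof (induction k)
  case 0
  then show ?case using A by auto
next
  case (Suc k)
  then show ?case
    using A upper_triangular_mult_diag[of "A ^\<^sub>m k" n A] by (auto simp: mult.commute)
qed

text \<open>For an eigenvector \<open>v\<close> the Hermitian form \<open>q\<close> of the matrix at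
  \<open>v\<close> is real and equals \<open>z\<close> times the positive squared norm
  \<open>s\<close>.\<close>

lemma real_eigenvalue_of_symmetric:
  fixes A :: "real mat"
  assumes A: "A \<in> carrier_mat n n" and sym: "transpose_mat A = A"
    and ev: "eigenvalue (map_mat complex_of_real A) z"
  shows "Im z = 0"
proof -
  from ev A obtain v where v: "v \<in> carrier_vec n" "v \<noteq> 0\<^sub>v n"
    and Av: "map_mat complex_of_real A *\<^sub>v v = z \<cdot>\<^sub>v v"
    by (auto simp: eigenvalue_def eigenvector_def)
  have symA: "A $$ (i, j) = A $$ (j, i)" if "i < n" "j < n" for i j
    using A that arg_cong[OF sym, of "\<lambda>M. M $$ (i, j)"] by simp
  define q where "q = (\<Sum>i<n. \<Sum>j<n. cnj (v $ i) * of_real (A $$ (i, j)) * v $ j)"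
  define s where "s = (\<Sum>i<n. (cmod (v $ i))\<^sup>2)"
  have row: "(\<Sum>j<n. of_real (A $$ (i, j)) * v $ j) = z * v $ i" if "i < n" for i
    using arg_cong[OF Av, of "\<lambda>w. w $ i"] A v that by (simp add: scalar_prod_def atLeast0LessThan)
  have "q = (\<Sum>i<n. cnj (v $ i) * (\<Sum>j<n. of_real (A $$ (i, j)) * v $ j))"
    by (simp add: q_def sum_distrib_left mult.assoc)
  also have "\<dots> = (\<Sum>i<n. cnj (v $ i) * (z * v $ i))" by (simp add: row)
  also have "\<dots> = z * of_real s"
    unfolding s_def of_real_sum sum_distrib_left
    by (rule sum.cong) (simp_all only: complex_norm_square mult_ac)
  finally have q: "q = z * of_real s" .
  \<comment> \<open>Conjugation exchanges the roles of the two indices, which symmetry of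
    \<open>A\<close> undoes; so \<open>q\<close> is real.\<close>
  have "cnj q = (\<Sum>i<n. \<Sum>j<n. cnj (v $ j) * of_real (A $$ (i, j)) * v $ i)"
    by (simp add: q_def mult_ac)
  also have "\<dots> = (\<Sum>j<n. \<Sum>i<n. cnj (v $ j) * of_real (A $$ (i, j)) * v $ i)" by (rule sum.swap)
  also have "\<dots> = q" unfolding q_def by (intro sum.cong refl) (simp add: symA)
  finally have "Im q = 0" by (metis complex_cnj_cancel_iff cnj.simps(2) neg_equal_zero)
  moreover have "s > 0"
  proof -
    obtain i where "i < n" "v $ i \<noteq> 0" using v by (metis eq_vecI carrier_vecD index_zero_vec)
    then show ?thesis unfolding s_def by (intro sum_pos2[of _ i]) auto
  qed
  ultimately show ?thesis unfolding q by simp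
qed

text \<open>The polynomial splits over the complex numbers, all its roots are real, and injectivity
  of the embedding of polynomials pulls the factorization back.\<close>

lemma symmetric_char_poly_splits:
  fixes A :: "real mat"
  assumes A: "A \<in> carrier_mat n n" and sym: "transpose_mat A = A"
  obtains es where "char_poly A = (\<Prod>e\<leftarrow>es. [:- e, 1:])" and "length es = n"
proof -
  let ?C = "map_mat complex_of_real A"
  have C: "?C \<in> carrier_mat n n" using A by simp
  from char_poly_factorized[OF C] obtain as
    where as: "char_poly ?C = (\<Prod>a\<leftarrow>as. [:- a, 1:])" "length as = n" by auto
  have real: "complex_of_real (Re a) = a" if "a \<in> set as" for a
  proof -
    have "poly (char_poly ?C) a = 0" using that
      by (simp add: as poly_prod_list prod_list_zero_iff)
    then have "eigenvalue ?C a" using eigenvalue_root_char_poly[OF C] by simp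
    then show ?thesis using real_eigenvalue_of_symmetric[OF A sym] by (simp add: complex_eq_iff)
  qed
  interpret h: map_poly_inj_idom_hom complex_of_real ..
  have "map_poly complex_of_real (char_poly A) = (\<Prod>a\<leftarrow>as. [:- a, 1:])"
    unfolding as(1)[symmetric] by (rule of_real_hom.char_poly_hom[OF A, symmetric])
  also have "\<dots> = (\<Prod>a\<leftarrow>as. map_poly complex_of_real [:- Re a, 1:])"
    using real by (intro arg_cong[of _ _ prod_list] map_cong) auto
  also have "\<dots> = map_poly complex_of_real (\<Prod>e\<leftarrow>map Re as. [:- e, 1:])"
    by (simp add: h.hom_prod_list o_def)
  finally have "char_poly A = (\<Prod>e\<leftarrow>map Re as. [:- e, 1:])" by simp
  with as(2) that show thesis by (metis length_map)
qed

text \<open>Schur triangularization gives a similar triangular matrix with diagonal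
  \<open>es\<close>. Powers respect the similarity and act entrywise on that diagonal, so roots are
  counted with algebraic multiplicity.\<close>

lemma mat_trace_pow_eq_power_sum:
  fixes A :: "'a :: conjugatable_ordered_field mat"
  assumes A: "A \<in> carrier_mat n n" and cp: "char_poly A = (\<Prod>e\<leftarrow>es. [:- e, 1:])"
  shows "mat_trace (A ^\<^sub>m k) = (\<Sum>e\<leftarrow>es. e ^ k)"
proof -
  obtain B P Q where s: "schur_decomposition A es = (B, P, Q)" by (cases "schur_decomposition A es")
  from schur_decomposition[OF A cp s] have w: "similar_mat_wit A B P Q"
    and B: "upper_triangular B" "diag_mat B = es" by auto
  from similar_mat_witD2[OF A w] have Bn: "B \<in> carrier_mat n n" by simp
  have "mat_trace (A ^\<^sub>m k) = mat_trace (B ^\<^sub>m k)"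
    by (rule mat_trace_similar[OF pow_carrier_mat[OF A] similar_mat_wit_pow[OF w]])
  also have "\<dots> = (\<Sum>i<n. (B $$ (i, i)) ^ k)"
    using upper_triangular_pow[OF Bn B(1), of k] Bn by (simp add: mat_trace_def)
  also have "\<dots> = (\<Sum>e\<leftarrow>es. e ^ k)"
    unfolding B(2)[symmetric] using Bn
    by (simp add: diag_mat_def o_def sum_list_sum_nth atLeast0LessThan)
  finally show ?thesis .
qed

section \<open>Multiplicity of the eigenvalue zero\<close>

lemma zero_columns_dvd_char_poly:
  fixes B :: "'a :: idom mat"
  assumes B: "B \<in> carrier_mat n n" and R: "R \<subseteq> {..<n}"
    and zero: "\<And>i r. i < n \<Longrightarrow> r \<in> R \<Longrightarrow> B $$ (i, r) = 0"
  shows "[:0, 1:] ^ card R dvd char_poly B"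
proof -
  \<comment> \<open>Column \<open>r \<in> R\<close> of the characteristic matrix is the
    indeterminate times a unit vector. \<open>D\<close> collects these factors and \<open>Q\<close>
    is what remains after pulling them out.\<close>
  define D where "D = mat n n (\<lambda>(i, j). if i = j then if i \<in> R then [:0, 1:] else 1 else 0 :: 'a poly)"
  define Q where "Q = mat n n (\<lambda>(i, j). if j \<in> R then if i = j then 1 else 0 else char_poly_matrix B $$ (i, j))"
  have c: "D \<in> carrier_mat n n" "Q \<in> carrier_mat n n" by (auto simp: D_def Q_def)
  have "char_poly_matrix B = Q * D"
  proof (rule eq_matI)
    fix i j assume "i < dim_row (Q * D)" "j < dim_col (Q * D)"
    then have ij: "i < n" "j < n" using c by auto
    have "(Q * D) $$ (i, j) = (\<Sum>k<n. Q $$ (i, k) * D $$ (k, j))"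
      using c ij by (auto simp: scalar_prod_def atLeast0LessThan)
    also have "\<dots> = (\<Sum>k\<in>{j}. Q $$ (i, k) * D $$ (k, j))"
      by (rule sum.mono_neutral_right) (use ij in \<open>auto simp: D_def\<close>)
    also have "\<dots> = char_poly_matrix B $$ (i, j)"
      using ij zero[of i j] B by (auto simp: D_def Q_def char_poly_matrix_def)
    finally show "char_poly_matrix B $$ (i, j) = (Q * D) $$ (i, j)" ..
  qed (use B c in \<open>auto simp: char_poly_matrix_def\<close>)
  then have "char_poly B = det Q * det D"
    using det_mult[OF c(2,1)] by (simp add: char_poly_def)
  moreover have "det D = (\<Prod>i<n. if i \<in> R then [:0, 1:] else 1)"
  proof -
    have "det D = prod_list (diag_mat D)"
      by (rule det_upper_triangular[OF _ c(1)]) (auto simp: D_def)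
    also have "diag_mat D = map (\<lambda>i. if i \<in> R then [:0, 1:] else 1) [0..<n]"
      by (auto simp: diag_mat_def D_def)
    finally show ?thesis
      by (simp add: prod.distinct_set_conv_list[symmetric] atLeast0LessThan)
  qed
  moreover have "\<dots> = [:0, 1:] ^ card R"
    using R by (simp add: prod.If_cases Int_absorb1)
  ultimately show ?thesis by simp
qed

text \<open>
  The change of basis that replaces the unit vectors at the positions \<open>r ` C\<close> by the kernel vectors
  is \<open>1 + N\<close> with \<open>N\<^sup>2 = 0\<close>, so its inverse is \<open>1 - N\<close>.
\<close>

lemma kernel_vectors_dvd_char_poly:
  fixes A :: "'a :: field mat"
  assumes A: "A \<in> carrier_mat n n" and inj: "inj_on r C" and r: "r ` C \<subseteq> {..<n}"
    and ker: "\<And>c i. c \<in> C \<Longrightarrow> i < n \<Longrightarrow> (\<Sum>j<n. A $$ (i, j) * x c j) = 0"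
    and dual: "\<And>c d. c \<in> C \<Longrightarrow> d \<in> C \<Longrightarrow> x c (r d) = (if c = d then 1 else 0)"
  shows "[:0, 1:] ^ card C dvd char_poly A"
proof -
  define s where "s = the_inv_into C r"
  have s: "s j \<in> C" "r (s j) = j" if "j \<in> r ` C" for j
    using that inj by (auto simp: s_def the_inv_into_into f_the_inv_into_f)
  \<comment> \<open>\<open>N\<close> is chosen so that the columns of \<open>1 + N\<close> at the
    positions in the image of \<open>r\<close> are the kernel vectors, and its other columns are
    unit vectors.\<close>
  define N where "N = mat n n (\<lambda>(i, j). if j \<in> r ` C then x (s j) i - (if i = j then 1 else 0) else 0)"
  have N: "N \<in> carrier_mat n n" by (simp add: N_def)
  \<comment> \<open>Nonzero columns of \<open>N\<close> sit at positions in the image of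
    \<open>r\<close>, and there \<open>dual\<close> makes the rows at such positions vanish.\<close>
  have NN: "N * N = 0\<^sub>m n n"
  proof (rule eq_matI)
    fix i j assume ij: "i < dim_row (0\<^sub>m n n :: 'a mat)" "j < dim_col (0\<^sub>m n n :: 'a mat)"
    have "N $$ (i, k) * N $$ (k, j) = 0" if k: "k < n" for k
    proof (cases "k \<in> r ` C \<and> j \<in> r ` C")
      case True
      then have "x (s j) (r (s k)) = (if s j = s k then 1 else 0)" using s dual by blast
      moreover have "s j = s k \<longleftrightarrow> j = k" using True s by metis
      ultimately have "N $$ (k, j) = 0" using True s ij k by (auto simp: N_def)
      then show ?thesis by simp
    qed (use ij k in \<open>auto simp: N_def\<close>)
    then show "(N * N) $$ (i, j) = 0\<^sub>m n n $$ (i, j)"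
      using N ij by (auto simp: scalar_prod_def intro!: sum.neutral)
  qed (use N in auto)
  define T where "T = 1\<^sub>m n + N"
  define S where "S = 1\<^sub>m n - N"
  have TS: "T \<in> carrier_mat n n" "S \<in> carrier_mat n n" using N by (auto simp: T_def S_def)
  have "T * S = 1\<^sub>m n * S + N * S"
    unfolding T_def using N TS by (intro add_mult_distrib_mat[of _ n n]) auto
  also have "N * S = N * 1\<^sub>m n - N * N"
    unfolding S_def using N by (intro mult_minus_distrib_mat[of _ n n]) auto
  finally have TS1: "T * S = 1\<^sub>m n"
    using N by (intro eq_matI) (auto simp: NN S_def)
  then have ST1: "S * T = 1\<^sub>m n" using mat_mult_left_right_inverse[OF TS(1) TS(2)] by simp
  have T_col: "T $$ (i, j) = x (s j) i" if "i < n" "j \<in> r ` C" for i j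
    using that r by (auto simp: T_def N_def)
  \<comment> \<open>\<open>B\<close> is \<open>A\<close> in the new basis. Its columns at the kernel
    positions are zero because those of \<open>A * T\<close> already are.\<close>
  define B where "B = S * (A * T)"
  have B: "B \<in> carrier_mat n n" using TS A by (simp add: B_def)
  have AT: "(A * T) $$ (i, j) = 0" if "i < n" "j \<in> r ` C" for i j
  proof -
    have "(A * T) $$ (i, j) = (\<Sum>k<n. A $$ (i, k) * x (s j) k)"
      using A TS that r T_col by (auto simp: scalar_prod_def atLeast0LessThan intro!: sum.cong)
    then show ?thesis using ker[of "s j" i] s that by simp
  qed
  have "B $$ (i, j) = 0" if "i < n" "j \<in> r ` C" for i j
  proof -
    have "B $$ (i, j) = (\<Sum>k<n. S $$ (i, k) * (A * T) $$ (k, j))"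
      unfolding B_def using A TS that r by (subst index_mult_mat) (auto simp: scalar_prod_def atLeast0LessThan)
    also have "\<dots> = 0" using AT that by (intro sum.neutral) simp
    finally show ?thesis .
  qed
  from zero_columns_dvd_char_poly[OF B r this]
  have "[:0, 1:] ^ card (r ` C) dvd char_poly B" by simp
  moreover have "similar_mat B A"
    unfolding similar_mat_def
    by (intro exI[of _ S] exI[of _ T] similar_mat_witI[of S T n B A]) (use A TS B TS1 ST1 in \<open>auto simp: B_def assoc_mult_mat[of S n n A n T n]\<close>)
  ultimately show ?thesis
    using inj by (simp add: card_image char_poly_similar)
qed

text \<open>The order of vanishing at \<open>0\<close> is additive over products, and a linear
  factor contributes one exactly when its root is \<open>0\<close>.\<close>

lemma power_dvd_prod_linear_imp_count_le:
  fixes es :: "'a :: idom list"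
  assumes "[:0, 1:] ^ k dvd (\<Prod>e\<leftarrow>es. [:- e, 1:])"
  shows "k \<le> count_list es 0"
proof -
  have ne: "(\<Prod>e\<leftarrow>es. [:- e, 1:]) \<noteq> 0" by (auto simp: prod_list_zero_iff)
  have "Polynomial.order 0 (\<Prod>e\<leftarrow>es. [:- e, 1:]) = count_list es 0"
    using ne
  proof (induction es)
    case (Cons e es)
    have "Polynomial.order 0 (\<Prod>e\<leftarrow>e # es. [:- e, 1:])
        = Polynomial.order 0 [:- e, 1:] + Polynomial.order 0 (\<Prod>e\<leftarrow>es. [:- e, 1:])"
      unfolding list.map prod_list.Cons
      by (rule order_mult) (use Cons.prems in \<open>simp only: list.map prod_list.Cons simp_thms\<close>)
    moreover have "Polynomial.order 0 [:- e, 1:] = (if e = 0 then 1 else 0)"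
      by (simp add: order_linear' order_0I)
    moreover have "Polynomial.order 0 (\<Prod>e\<leftarrow>es. [:- e, 1:]) = count_list es 0"
      by (rule Cons.IH) (auto simp: prod_list_zero_iff)
    ultimately show ?case by simp
  qed simp
  moreover from assms ne have "k \<le> Polynomial.order 0 (\<Prod>e\<leftarrow>es. [:- e, 1:])"
    by (intro order_max) auto
  ultimately show ?thesis by simp
qed

section \<open>Switching on balanced components\<close>

lemma cycle_sign_simps [simp]:
  "cycle_sign G \<sigma> [] = 1"
  "cycle_sign G \<sigma> (e # p) = \<sigma> {tail G e, head G e} * cycle_sign G \<sigma> p"
  "cycle_sign G \<sigma> (p @ q) = cycle_sign G \<sigma> p * cycle_sign G \<sigma> q"
  by (auto simp: cycle_sign_def)

text \<open>Strong induction on the length. A closed walk without repeated inner vertices is a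
  genuine cycle or an edge run back and forth, whose sign is a square; any other splits into two
  shorter closed walks.\<close>

lemma (in loopfree_digraph) balanced_closed_walk_sign:
  assumes bal: "balanced G \<sigma>"
    and sign: "\<And>e. e \<in> arcs G \<Longrightarrow> \<sigma> {tail G e, head G e} = 1 \<or> \<sigma> {tail G e, head G e} = -1"
    and "awalk u p u"
  shows "cycle_sign G \<sigma> p = 1"
  using assms(3)
proof (induction "length p" arbitrary: p u rule: less_induct)
  case less
  show ?case
  proof (cases p)
    case (Cons e es)
    show ?thesis
    proof (cases "distinct (tl (awalk_verts u p))")
      case True
      have cyc: "cycle p" using True less.prems Cons unfolding cycle_def by auto
      then have "2 \<le> length p" unfolding cycle_digraph_conv by auto
      then consider "3 \<le> length p" | "length p = 2" by linarith
      then show ?thesis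
      proof cases
        case 1
        with bal cyc show ?thesis by (auto simp: balanced_def)
      next
        case 2
        then obtain f where p: "p = [e, f]" using Cons by (auto simp: length_Suc_conv numeral_2_eq_2)
        then have "tail G e = u" "head G e = tail G f" "head G f = u" "e \<in> arcs G"
          using less.prems by (auto simp: awalk_simps)
        then show ?thesis using sign[of e] by (auto simp: p insert_commute)
      qed
    next
      case False
      \<comment> \<open>Searching for the repetition in \<open>es\<close> instead of
        \<open>p\<close> keeps \<open>e\<close> out of the loop \<open>r\<close>, so
        \<open>r\<close> is strictly shorter than \<open>p\<close>.\<close>
      then have "awalk (head G e) es u" "\<not> distinct (awalk_verts (head G e) es)"
        using less.prems Cons by (auto simp: awalk_Cons_iff)
      from awalk_not_distinct_decomp[OF this] obtain q r s w
        where d: "es = q @ r @ s" "0 < length r"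
          "awalk (head G e) q w" "awalk w r w" "awalk w s u" by blast
      have "awalk u (e # q @ s) u"
        using d less.prems Cons by (auto simp: awalk_Cons_iff intro: awalk_appendI)
      then have "cycle_sign G \<sigma> (e # q @ s) = 1"
        using d Cons by (intro less.hyps) auto
      moreover have "cycle_sign G \<sigma> r = 1"
        using d Cons by (intro less.hyps[of _ w]) auto
      ultimately show ?thesis using d Cons by simp
    qed
  qed simp
qed

text \<open>Take \<open>\<theta> v\<close> to be the sign of any walk from \<open>r\<close> to
  \<open>v\<close>; since closed walks at \<open>r\<close> are positive, this does not depend on the
  walk.\<close>

lemma (in loopfree_digraph) balanced_switching:
  assumes bal: "balanced G \<sigma>" and sc: "strongly_connected G" and r: "r \<in> verts G"
    and sign: "\<And>e. e \<in> arcs G \<Longrightarrow> \<sigma> {tail G e, head G e} = 1 \<or> \<sigma> {tail G e, head G e} = -1"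
  obtains \<theta> where "\<theta> r = 1" and "\<And>u v. u \<rightarrow>\<^bsub>G\<^esub> v \<Longrightarrow> \<sigma> {u, v} * \<theta> v = (\<theta> u :: real)"
proof -
  define W where "W = (\<lambda>v. SOME p. awalk r p v)"
  have ex: "\<exists>p. awalk u p v" if "u \<in> verts G" "v \<in> verts G" for u v
    using sc that by (auto simp: strongly_connected_def reachable_awalk)
  have W: "awalk r (W v) v" if "v \<in> verts G" for v
    unfolding W_def by (rule someI_ex) (rule ex[OF r that])
  have closed: "cycle_sign G \<sigma> p = 1" if "awalk r p r" for p
    using balanced_closed_walk_sign[OF bal _ that] sign by blast
  show thesis
  proof
    \<comment> \<open>The chosen walk \<open>W r\<close> may be nonempty, but it is closed.\<close>
    show "cycle_sign G \<sigma> (W r) = 1" by (rule closed) (rule W[OF r])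
    fix u v assume "u \<rightarrow>\<^bsub>G\<^esub> v"
    then obtain e where e: "e \<in> arcs G" "tail G e = u" "head G e = v" by (auto simp: arcs_ends_conv)
    then have uv: "u \<in> verts G" "v \<in> verts G" by auto
    \<comment> \<open>One return walk \<open>w\<close> closes both the walk through \<open>u\<close>
      and the chosen walk to \<open>v\<close>; its sign then cancels from the comparison.\<close>
    from ex[OF uv(2) r] obtain w where w: "awalk v w r" by auto
    have "awalk r (W u @ e # w) r"
      using W[OF uv(1)] w e uv by (intro awalk_appendI[of _ _ u]) (auto simp: awalk_Cons_iff)
    from closed[OF this] have 1: "cycle_sign G \<sigma> (W u) * \<sigma> {u, v} * cycle_sign G \<sigma> w = 1"
      by (simp add: e mult.assoc)
    have "awalk r (W v @ w) r" using W[OF uv(2)] w by (rule awalk_appendI)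
    from closed[OF this] have 2: "cycle_sign G \<sigma> (W v) * cycle_sign G \<sigma> w = 1" by simp
    from 1 2 have "cycle_sign G \<sigma> (W u) * \<sigma> {u, v} = cycle_sign G \<sigma> (W v)"
      by (metis mult.assoc mult.commute mult.right_neutral)
    then have "\<sigma> {u, v} * cycle_sign G \<sigma> (W v) = \<sigma> {u, v} * \<sigma> {u, v} * cycle_sign G \<sigma> (W u)"
      by (metis mult.assoc mult.commute)
    moreover have "\<sigma> {u, v} * \<sigma> {u, v} = 1" using sign[OF e(1)] e by auto
    ultimately show "\<sigma> {u, v} * cycle_sign G \<sigma> (W v) = cycle_sign G \<sigma> (W u)" by simp
  qed
qed

section \<open>Signed Laplacians\<close>

text \<open>Matrix entries indexed by vertices rather than positions, so that graph computations are
  free of the enumeration.\<close>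

definition signed_adj :: "('a, 'b) pre_digraph \<Rightarrow> ('a set \<Rightarrow> real) \<Rightarrow> 'a \<Rightarrow> 'a \<Rightarrow> real" where
  "signed_adj G \<sigma> u v = (if u \<rightarrow>\<^bsub>G\<^esub> v then \<sigma> {u, v} else 0)"

definition signed_lap :: "('a, 'b) pre_digraph \<Rightarrow> ('a set \<Rightarrow> real) \<Rightarrow> 'a \<Rightarrow> 'a \<Rightarrow> real" where
  "signed_lap G \<sigma> u v = (if u = v then real (out_degree G u) else 0) - signed_adj G \<sigma> u v"

lemma (in graph) dominates_sym: "u \<rightarrow>\<^bsub>G\<^esub> v \<longleftrightarrow> v \<rightarrow>\<^bsub>G\<^esub> u"
  using sym_arcs arcs_ends_symmetric by metis

lemma (in graph) out_degree_eq_card_neighbours: "out_degree G u = card {v \<in> verts G. u \<rightarrow>\<^bsub>G\<^esub> v}"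
proof -
  have "card (head G ` out_arcs G u) = card (out_arcs G u)"
    by (rule card_image) (auto simp: inj_on_def arc_to_ends_def intro: no_multi_arcs)
  moreover have "head G ` out_arcs G u = {v \<in> verts G. u \<rightarrow>\<^bsub>G\<^esub> v}"
    by (auto simp: arcs_ends_conv)
  ultimately show ?thesis by (simp add: out_degree_def)
qed

context signed_graph
begin

abbreviation "a \<equiv> signed_adj G \<sigma>"
abbreviation "L \<equiv> signed_lap G \<sigma>"
abbreviation "d u \<equiv> real (out_degree G u)"

lemma a_commute: "a u v = a v u"
  using dominates_sym[of u v] by (auto simp: signed_adj_def insert_commute)

lemma L_commute: "L u v = L v u"
  using a_commute[of u v] by (simp add: signed_lap_def)

lemma a_self [simp]: "a u u = 0"
  using adj_not_same by (auto simp: signed_adj_def)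

lemma a_square: "a u v * a u v = (if u \<rightarrow>\<^bsub>G\<^esub> v then 1 else 0)"
  using signature[of u v] by (auto simp: signed_adj_def)

lemma degree_eq_sum: "d u = (\<Sum>v\<in>verts G. if u \<rightarrow>\<^bsub>G\<^esub> v then 1 else 0)"
  by (simp add: out_degree_eq_card_neighbours sum.If_cases Int_def)

lemma sum_a_square: "(\<Sum>v\<in>verts G. a u v * a u v) = d u"
  by (simp add: a_square degree_eq_sum)

lemma sum_L_mult:
  assumes "u \<in> verts G"
  shows "(\<Sum>v\<in>verts G. L u v * f v) = d u * f u - (\<Sum>v\<in>verts G. a u v * f v)"
  using assms by (simp add: signed_lap_def left_diff_distrib sum_subtractf if_distrib[of "\<lambda>x. x * _"] cong: if_cong)

section \<open>Traces and the quadratic form\<close>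

lemma trace_L: "(\<Sum>u\<in>verts G. L u u) = degree_power_sum G 1"
  by (simp add: signed_lap_def degree_power_sum_def)

lemma trace_L2: "(\<Sum>u\<in>verts G. \<Sum>v\<in>verts G. L u v * L v u) = degree_power_sum G 2 + degree_power_sum G 1"
proof -
  have "(\<Sum>v\<in>verts G. L u v * L v u) = d u ^ 2 + d u" if u: "u \<in> verts G" for u
  proof -
    have "(\<Sum>v\<in>verts G. a u v * L v u) = (\<Sum>v\<in>verts G. - (a u v * a u v))"
      by (rule sum.cong) (auto simp: signed_lap_def a_commute)
    also have "\<dots> = - d u" by (simp add: sum_negf sum_a_square)
    finally have "(\<Sum>v\<in>verts G. a u v * L v u) = - d u" .
    then show ?thesis unfolding sum_L_mult[OF u] by (simp add: signed_lap_def power2_eq_square)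
  qed
  then show ?thesis by (simp add: degree_power_sum_def sum.distrib)
qed

text \<open>The form is half the sum of \<open>(f u - a u v * f v)\<^sup>2\<close> over ordered
  adjacent pairs.\<close>

lemma quadratic_form_nonneg: "0 \<le> (\<Sum>u\<in>verts G. f u * (\<Sum>v\<in>verts G. L u v * f v))"
proof -
  let ?V = "verts G"
  define b :: "'a \<Rightarrow> 'a \<Rightarrow> real" where "b u v = (if u \<rightarrow>\<^bsub>G\<^esub> v then 1 else 0)" for u v
  have b: "b u v = b v u" for u v using dominates_sym[of u v] by (simp add: b_def)
  have "0 \<le> (\<Sum>u\<in>?V. \<Sum>v\<in>?V. b u v * (f u - a u v * f v)\<^sup>2)"
    by (intro sum_nonneg) (auto simp: b_def)
  \<comment> \<open>The second square carries \<open>b v u\<close> instead of \<open>b u v\<close>,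
    so that exchanging the summations turns its sum into the first one.\<close>
  also have "\<dots> = (\<Sum>u\<in>?V. \<Sum>v\<in>?V. b u v * (f u)\<^sup>2 + b v u * (f v)\<^sup>2 - 2 * (f u * (a u v * f v)))"
  proof (intro sum.cong refl)
    fix u v
    show "b u v * (f u - a u v * f v)\<^sup>2 = b u v * (f u)\<^sup>2 + b v u * (f v)\<^sup>2 - 2 * (f u * (a u v * f v))"
    proof (cases "u \<rightarrow>\<^bsub>G\<^esub> v")
      case True
      then have "(f u - a u v * f v)\<^sup>2 = (f u)\<^sup>2 + (f v)\<^sup>2 - 2 * (f u * (a u v * f v))"
        using signature[of u v] by (auto simp: signed_adj_def power2_eq_square algebra_simps)
      moreover have "b u v = 1" "b v u = 1" using True b[of u v] by (simp_all add: b_def)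
      ultimately show ?thesis by simp
    next
      case False
      then show ?thesis using b[of u v] by (simp add: b_def signed_adj_def)
    qed
  qed
  also have "\<dots> = (\<Sum>u\<in>?V. \<Sum>v\<in>?V. b u v * (f u)\<^sup>2) + (\<Sum>u\<in>?V. \<Sum>v\<in>?V. b v u * (f v)\<^sup>2)
      - 2 * (\<Sum>u\<in>?V. \<Sum>v\<in>?V. f u * (a u v * f v))"
    by (simp add: sum.distrib sum_subtractf sum_distrib_left)
  also have "(\<Sum>u\<in>?V. \<Sum>v\<in>?V. b v u * (f v)\<^sup>2) = (\<Sum>u\<in>?V. \<Sum>v\<in>?V. b u v * (f u)\<^sup>2)"
    by (rule sum.swap)
  also have "(\<Sum>u\<in>?V. \<Sum>v\<in>?V. b u v * (f u)\<^sup>2) = (\<Sum>u\<in>?V. d u * (f u)\<^sup>2)"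
    by (simp add: sum_distrib_right[symmetric] b_def degree_eq_sum)
  finally have "0 \<le> (\<Sum>u\<in>?V. d u * (f u)\<^sup>2) - (\<Sum>u\<in>?V. \<Sum>v\<in>?V. f u * (a u v * f v))" by simp
  also have "\<dots> = (\<Sum>u\<in>?V. f u * (\<Sum>v\<in>?V. L u v * f v))"
    unfolding sum_subtractf[symmetric]
  proof (intro sum.cong refl)
    fix u assume u: "u \<in> ?V"
    show "d u * (f u)\<^sup>2 - (\<Sum>v\<in>?V. f u * (a u v * f v)) = f u * (\<Sum>v\<in>?V. L u v * f v)"
      unfolding sum_L_mult[OF u] by (simp add: right_diff_distrib sum_distrib_left power2_eq_square mult_ac)
  qed
  finally show ?thesis .
qed

text \<open>Expand the cube of degree matrix minus adjacency matrix. Terms with one adjacency factor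
  have zero trace; each of the three terms with two such factors has trace
  \<open>degree_power_sum G 2\<close>.\<close>

lemma trace_L3_eq: "(\<Sum>u\<in>verts G. \<Sum>v\<in>verts G. \<Sum>w\<in>verts G. L u v * L v w * L w u)
  = degree_power_sum G 3 + 3 * degree_power_sum G 2
    - (\<Sum>u\<in>verts G. \<Sum>v\<in>verts G. \<Sum>w\<in>verts G. a u v * a v w * a w u)"
proof -
  let ?V = "verts G"
  \<comment> \<open>Of the three placements of the degree factor, two fall on the base vertex
    \<open>u\<close> and one on its neighbours; the latter becomes a sum of squares only after
    summing over \<open>u\<close>.\<close>
  have "(\<Sum>v\<in>?V. \<Sum>w\<in>?V. L u v * L v w * L w u)
      = d u ^ 3 + 2 * d u ^ 2 + (\<Sum>v\<in>?V. d v * (a u v * a u v)) - (\<Sum>v\<in>?V. \<Sum>w\<in>?V. a u v * a v w * a w u)"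
    if u: "u \<in> ?V" for u
  proof -
    \<comment> \<open>\<open>g\<close> is column \<open>u\<close> of the squared Laplacian.\<close>
    define g where "g v = (\<Sum>w\<in>?V. L v w * L w u)" for v
    have al: "(\<Sum>w\<in>?V. a v w * L w u) = a v u * d u - (\<Sum>w\<in>?V. a v w * a w u)" for v
      using u by (simp add: signed_lap_def right_diff_distrib sum_subtractf if_distrib[of "\<lambda>x. _ * x"] cong: if_cong)
    have g: "g v = d v * L v u - a v u * d u + (\<Sum>w\<in>?V. a v w * a w u)" if "v \<in> ?V" for v
      unfolding g_def sum_L_mult[OF that] al by simp
    have gu: "g u = d u ^ 2 + d u"
      unfolding g[OF u] using a_commute by (simp add: signed_lap_def power2_eq_square sum_a_square[symmetric])
    have ag: "a u v * g v = - (d v * (a u v * a u v)) - d u * (a u v * a u v) + (\<Sum>w\<in>?V. a u v * a v w * a w u)"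
      if "v \<in> ?V" for v
      unfolding g[OF that] using a_commute[of v u]
      by (cases "u = v") (simp_all add: signed_lap_def sum_distrib_left algebra_simps)
    have "(\<Sum>v\<in>?V. \<Sum>w\<in>?V. L u v * L v w * L w u) = (\<Sum>v\<in>?V. L u v * g v)"
      by (simp add: g_def sum_distrib_left mult.assoc)
    also have "\<dots> = d u * g u - (\<Sum>v\<in>?V. a u v * g v)" by (rule sum_L_mult[OF u])
    also have "(\<Sum>v\<in>?V. a u v * g v) = - (\<Sum>v\<in>?V. d v * (a u v * a u v)) - d u * d u
        + (\<Sum>v\<in>?V. \<Sum>w\<in>?V. a u v * a v w * a w u)"
      using sum_a_square[of u] by (simp add: ag sum.distrib sum_subtractf sum_negf sum_distrib_left[symmetric])
    finally show ?thesis
      unfolding gu by (simp add: power2_eq_square power3_eq_cube algebra_simps)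
  qed
  moreover have "(\<Sum>u\<in>?V. \<Sum>v\<in>?V. d v * (a u v * a u v)) = (\<Sum>v\<in>?V. d v ^ 2)"
  proof -
    have "(\<Sum>u\<in>?V. \<Sum>v\<in>?V. d v * (a u v * a u v)) = (\<Sum>v\<in>?V. d v * (\<Sum>u\<in>?V. a v u * a v u))"
      by (subst sum.swap) (simp add: sum_distrib_left a_commute)
    then show ?thesis by (simp add: sum_a_square power2_eq_square)
  qed
  ultimately show ?thesis
    by (simp add: degree_power_sum_def sum.distrib sum_subtractf sum_distrib_left[symmetric])
qed

section \<open>Kernel vectors from balanced components\<close>

lemma sccs_adj_iff:
  assumes H: "H \<in> sccs" and uv: "u \<rightarrow>\<^bsub>G\<^esub> v"
  shows "u \<in> verts H \<longleftrightarrow> v \<in> verts H"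
    and "u \<in> verts H \<Longrightarrow> u \<rightarrow>\<^bsub>H\<^esub> v"
proof -
  have S: "verts H \<in> sccs_verts" using H by (auto simp: sccs_verts_conv)
  have "u \<rightarrow>\<^sup>*\<^bsub>G\<^esub> v" "v \<rightarrow>\<^sup>*\<^bsub>G\<^esub> u" using uv dominates_sym[of u v] by auto
  then show iff: "u \<in> verts H \<longleftrightarrow> v \<in> verts H"
    using S unfolding in_sccs_verts_conv_reachable by blast
  assume "u \<in> verts H"
  with iff uv H show "u \<rightarrow>\<^bsub>H\<^esub> v"
    by (auto simp: sccs_def arcs_ends_conv induced_subgraph_def subgraph_def compatible_def image_iff)
qed

text \<open>Extend the switching function of \<open>H\<close> by zero. No edge leaves
  \<open>H\<close>, so each neighbour of \<open>u\<close> contributes exactly \<open>x u\<close> to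
  the signed adjacency sum, which cancels the degree term.\<close>

lemma balanced_scc_kernel_vector:
  assumes H: "H \<in> sccs" and bal: "balanced H \<sigma>" and r: "r \<in> verts H"
  obtains x where "x r = 1" and "\<And>v. v \<notin> verts H \<Longrightarrow> x v = 0"
    and "\<And>u. u \<in> verts G \<Longrightarrow> (\<Sum>v\<in>verts G. L u v * x v) = 0"
proof -
  from H have ind: "induced_subgraph H G" and sc: "strongly_connected H" by auto
  interpret H: digraph H using ind by (rule digraphI_induced)
  have "\<sigma> {tail H e, head H e} = 1 \<or> \<sigma> {tail H e, head H e} = -1" if "e \<in> arcs H" for e
  proof (rule signature)
    have "(tail G e, head G e) \<in> arcs_ends G" using ind that
      by (auto simp: arcs_ends_conv induced_subgraph_def)
    moreover have "tail H = tail G" "head H = head G" using ind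
      by (simp_all add: induced_subgraph_def subgraph_def compatible_def)
    ultimately show "tail H e \<rightarrow>\<^bsub>G\<^esub> head H e" by simp
  qed
  from H.balanced_switching[OF bal sc r this] obtain \<theta>
    where \<theta>: "\<theta> r = 1" "\<And>u v. u \<rightarrow>\<^bsub>H\<^esub> v \<Longrightarrow> \<sigma> {u, v} * \<theta> v = \<theta> u" by blast
  define x where "x v = (if v \<in> verts H then \<theta> v else 0)" for v
  show thesis
  proof
    show "x r = 1" using \<theta> r by (simp add: x_def)
    show "x v = 0" if "v \<notin> verts H" for v using that by (simp add: x_def)
    fix u assume u: "u \<in> verts G"
    have "a u v * x v = (if u \<rightarrow>\<^bsub>G\<^esub> v then 1 else 0) * x u" for v
    proof (cases "u \<rightarrow>\<^bsub>G\<^esub> v")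
      case True
      from sccs_adj_iff[OF H True] \<theta>(2)[of u v] show ?thesis
        by (auto simp: x_def signed_adj_def True)
    qed (simp add: signed_adj_def)
    then have "(\<Sum>v\<in>verts G. a u v * x v) = d u * x u"
      by (simp only: degree_eq_sum sum_distrib_right)
    then show "(\<Sum>v\<in>verts G. L u v * x v) = 0" by (simp add: sum_L_mult[OF u])
  qed
qed

end

section \<open>Triangles\<close>

lemma triangle_sign_insert:
  assumes "u \<noteq> v" "v \<noteq> w" "w \<noteq> u"
  shows "triangle_sign \<sigma> {u, v, w} = \<sigma> {u, v} * \<sigma> {v, w} * \<sigma> {w, u}"
proof -
  have "{e. e \<subseteq> {u, v, w} \<and> card e = 2} = {{u, v}, {v, w}, {w, u}}"
  proof (intro equalityI subsetI)
    fix e assume "e \<in> {e. e \<subseteq> {u, v, w} \<and> card e = 2}"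
    then show "e \<in> {{u, v}, {v, w}, {w, u}}" by (auto simp: card_2_iff doubleton_eq_iff)
  qed (use assms in auto)
  moreover have "{u, v} \<noteq> {v, w}" "{u, v} \<noteq> {w, u}" "{v, w} \<noteq> {w, u}"
    using assms by (auto simp: doubleton_eq_iff)
  ultimately show ?thesis by (simp add: triangle_sign_def mult.assoc)
qed

context signed_graph
begin

lemma trianglesE:
  assumes "T \<in> triangles G"
  obtains x y z where "T = {x, y, z}" "x \<noteq> y" "y \<noteq> z" "z \<noteq> x"
    "x \<rightarrow>\<^bsub>G\<^esub> y" "y \<rightarrow>\<^bsub>G\<^esub> z" "z \<rightarrow>\<^bsub>G\<^esub> x" "y \<rightarrow>\<^bsub>G\<^esub> x" "z \<rightarrow>\<^bsub>G\<^esub> y" "x \<rightarrow>\<^bsub>G\<^esub> z"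
proof -
  from assms obtain x y z where "T = {x, y, z}" "x \<noteq> y" "y \<noteq> z" "x \<noteq> z"
    by (auto simp: triangles_def card_3_iff)
  with assms show thesis by (intro that[of x y z]) (auto simp: triangles_def)
qed

lemma finite_triangles: "finite (triangles G)"
  by (rule finite_subset[of _ "Pow (verts G)"]) (auto simp: triangles_def)

text \<open>A sign is the difference of the indicators of being positive and being negative.\<close>

lemma net_triangles_eq_sum: "net_triangles G \<sigma> = (\<Sum>T\<in>triangles G. triangle_sign \<sigma> T)"
proof -
  have "triangle_sign \<sigma> T = 1 \<or> triangle_sign \<sigma> T = -1" if "T \<in> triangles G" for T
    using that
  proof (cases rule: trianglesE)
    case (1 x y z)
    then show ?thesis using signature[of x y] signature[of y z] signature[of z x]
      by (auto simp: triangle_sign_insert)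
  qed
  then have "(\<Sum>T\<in>triangles G. triangle_sign \<sigma> T)
      = (\<Sum>T\<in>triangles G. (if triangle_sign \<sigma> T = 1 then 1 else 0) - (if triangle_sign \<sigma> T = -1 then 1 else 0))"
    by (intro sum.cong) force+
  also have "\<dots> = net_triangles G \<sigma>"
    by (simp add: sum_subtractf sum.If_cases finite_triangles net_triangles_def
        num_positive_triangles_def num_negative_triangles_def Int_def)
  finally show ?thesis ..
qed

text \<open>Nonzero terms are the closed walks around triangles. Grouping them by vertex set gives
  six walks per triangle, all with its sign.\<close>

lemma sum_closed_3_walks:
  "(\<Sum>u\<in>verts G. \<Sum>v\<in>verts G. \<Sum>w\<in>verts G. a u v * a v w * a w u) = 6 * net_triangles G \<sigma>"
proof -
  let ?V = "verts G"
  define W where "W = {(u, v, w). u \<rightarrow>\<^bsub>G\<^esub> v \<and> v \<rightarrow>\<^bsub>G\<^esub> w \<and> w \<rightarrow>\<^bsub>G\<^esub> u}"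
  define T where "T = (\<lambda>(u, v, w). {u, v, w} :: 'a set)"
  have W_sub: "W \<subseteq> ?V \<times> ?V \<times> ?V" by (auto simp: W_def dest: adj_in_verts)
  then have fin: "finite W" by (rule finite_subset) simp
  have neq: "u \<noteq> v" if "u \<rightarrow>\<^bsub>G\<^esub> v" for u v using that adj_not_same by blast
  have "(\<Sum>u\<in>?V. \<Sum>v\<in>?V. \<Sum>w\<in>?V. a u v * a v w * a w u)
      = (\<Sum>(u, v, w)\<in>?V \<times> ?V \<times> ?V. a u v * a v w * a w u)"
    by (simp add: sum.cartesian_product)
  also have "\<dots> = (\<Sum>(u, v, w)\<in>W. a u v * a v w * a w u)"
    using W_sub by (intro sum.mono_neutral_right) (auto simp: W_def signed_adj_def split: if_splits)
  also have "\<dots> = (\<Sum>x\<in>W. triangle_sign \<sigma> (T x))"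
  proof (intro sum.cong refl, safe)
    fix u v w assume "(u, v, w) \<in> W"
    then have e: "u \<rightarrow>\<^bsub>G\<^esub> v" "v \<rightarrow>\<^bsub>G\<^esub> w" "w \<rightarrow>\<^bsub>G\<^esub> u" by (simp_all add: W_def)
    show "a u v * a v w * a w u = triangle_sign \<sigma> (T (u, v, w))"
      using e triangle_sign_insert[OF e[THEN neq]] by (simp add: T_def signed_adj_def)
  qed
  also have "\<dots> = (\<Sum>t\<in>triangles G. \<Sum>x\<in>{x \<in> W. T x = t}. triangle_sign \<sigma> (T x))"
  proof (rule sum.group[symmetric, OF fin finite_triangles], safe)
    fix u v w assume W: "(u, v, w) \<in> W"
    then have "u \<noteq> v" "v \<noteq> w" "w \<noteq> u" using neq unfolding W_def by blast+
    moreover have "v \<rightarrow>\<^bsub>G\<^esub> u" "w \<rightarrow>\<^bsub>G\<^esub> v" "u \<rightarrow>\<^bsub>G\<^esub> w"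
      using W dominates_sym by (auto simp: W_def)
    ultimately show "T (u, v, w) \<in> triangles G"
      using W W_sub by (auto simp: W_def T_def triangles_def card_3_iff)
  qed
  also have "\<dots> = (\<Sum>t\<in>triangles G. 6 * triangle_sign \<sigma> t)"
  proof (rule sum.cong[OF refl])
    fix t assume "t \<in> triangles G"
    then show "(\<Sum>x\<in>{x \<in> W. T x = t}. triangle_sign \<sigma> (T x)) = 6 * triangle_sign \<sigma> t"
    proof (cases rule: trianglesE)
      case (1 x y z)
      \<comment> \<open>The six walks arise from three starting points and two directions.\<close>
      have "{p \<in> W. T p = t} = {(x,y,z), (x,z,y), (y,x,z), (y,z,x), (z,x,y), (z,y,x)}" (is "_ = ?S")
      proof (intro equalityI subsetI)
        fix p assume "p \<in> {p \<in> W. T p = t}"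
        then obtain u v w where p: "p = (u, v, w)" "(u, v, w) \<in> W" "{u, v, w} = {x, y, z}"
          using 1(1) by (cases p) (auto simp: T_def)
        then have "u \<noteq> v" "v \<noteq> w" "w \<noteq> u" using neq unfolding W_def by blast+
        moreover have "u \<in> {x, y, z}" "v \<in> {x, y, z}" "w \<in> {x, y, z}" using p(3) by blast+
        ultimately show "p \<in> ?S" unfolding p(1) by auto
      next
        fix p assume "p \<in> ?S"
        then show "p \<in> {p \<in> W. T p = t}" using 1 by (auto simp: W_def T_def)
      qed
      moreover have "card ?S = 6" using 1(2-4) by auto
      moreover have "(\<Sum>x\<in>{x \<in> W. T x = t}. triangle_sign \<sigma> (T x)) = real (card {x \<in> W. T x = t}) * triangle_sign \<sigma> t"
        by simp
      ultimately show ?thesis by simp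
    qed
  qed
  also have "\<dots> = 6 * net_triangles G \<sigma>"
    by (simp add: net_triangles_eq_sum sum_distrib_left)
  finally show ?thesis .
qed

lemma trace_L3: "(\<Sum>u\<in>verts G. \<Sum>v\<in>verts G. \<Sum>w\<in>verts G. L u v * L v w * L w u)
  = degree_power_sum G 3 + 3 * degree_power_sum G 2 - 6 * net_triangles G \<sigma>"
  unfolding trace_L3_eq sum_closed_3_walks by simp

end

section \<open>The spectrum of the Laplacian\<close>

context signed_graph
begin

text \<open>One vertex \<open>r c\<close> is picked in each balanced component. Disjoint supports
  make the kernel vectors dual to these vertices, the form of independence that
  \<open>kernel_vectors_dvd_char_poly\<close> expects.\<close>

lemma num_balanced_kernel:
  obtains C :: "('a, 'b) pre_digraph set" and r x where "card C = num_balanced_components G \<sigma>" and "inj_on r C" and "r ` C \<subseteq> verts G"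
    and "\<And>c u. c \<in> C \<Longrightarrow> u \<in> verts G \<Longrightarrow> (\<Sum>v\<in>verts G. L u v * x c v) = 0"
    and "\<And>c c'. c \<in> C \<Longrightarrow> c' \<in> C \<Longrightarrow> x c (r c') = (if c = c' then 1 else 0 :: real)"
proof -
  define C where "C = {H \<in> sccs. balanced H \<sigma>}"
  define r where "r H = (SOME v. v \<in> verts H)" for H :: "('a, 'b) pre_digraph"
  have r: "r H \<in> verts H" if "H \<in> C" for H
  proof -
    from that have "strongly_connected H" by (auto simp: C_def)
    then show ?thesis unfolding r_def by (auto simp: strongly_connected_def some_in_eq)
  qed
  have "\<exists>x. x (r H) = 1 \<and> (\<forall>v. v \<notin> verts H \<longrightarrow> x v = 0) \<and> (\<forall>u\<in>verts G. (\<Sum>v\<in>verts G. L u v * x v) = 0)"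
    if "H \<in> C" for H
  proof (rule balanced_scc_kernel_vector)
    show "H \<in> sccs" "balanced H \<sigma>" using that by (auto simp: C_def)
    show "r H \<in> verts H" by (rule r[OF that])
  qed blast
  then obtain x where x: "\<And>H. H \<in> C \<Longrightarrow> x H (r H) = 1"
      "\<And>H v. H \<in> C \<Longrightarrow> v \<notin> verts H \<Longrightarrow> x H v = 0"
      "\<And>H u. H \<in> C \<Longrightarrow> u \<in> verts G \<Longrightarrow> (\<Sum>v\<in>verts G. L u v * x H v) = 0"
    by metis
  have disj: "r H' \<notin> verts H" if "H \<in> C" "H' \<in> C" "H \<noteq> H'" for H H'
    using scc_disj[of H H'] r[of H'] that by (auto simp: C_def)
  show thesis
  proof
    show "card C = num_balanced_components G \<sigma>" by (simp add: C_def num_balanced_components_def)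
    show "inj_on r C" using disj r by (metis inj_onI)
    have "verts H \<subseteq> verts G" if "H \<in> C" for H
      using that by (auto simp: C_def sccs_def induced_subgraph_def subgraph_def)
    then show "r ` C \<subseteq> verts G" using r by blast
    show "(\<Sum>v\<in>verts G. L u v * x c v) = 0" if "c \<in> C" "u \<in> verts G" for c u using x(3) that .
    show "x c (r c') = (if c = c' then 1 else 0)" if "c \<in> C" "c' \<in> C" for c c'
      using that x(1,2) disj by auto
  qed
qed

lemma laplacian_carrier: "laplacian G \<sigma> vs \<in> carrier_mat (length vs) (length vs)"
  by (auto simp: laplacian_def degree_matrix_def adjacency_matrix_def)

lemma laplacian_index:
  assumes "distinct vs" "i < length vs" "j < length vs"
  shows "laplacian G \<sigma> vs $$ (i, j) = L (vs ! i) (vs ! j)"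
  using assms
  by (simp add: laplacian_def degree_matrix_def adjacency_matrix_def signed_lap_def signed_adj_def nth_eq_iff_index_eq)

end

section \<open>Transfer from vertices to matrix indices\<close>

locale enumerated_signed_graph = signed_graph +
  fixes vs
  assumes distinct_vs: "distinct vs" and set_vs: "set vs = verts G"
begin

abbreviation "M \<equiv> laplacian G \<sigma> vs"
abbreviation "n \<equiv> length vs"

lemma length_vs: "n = card (verts G)"
  using distinct_card[OF distinct_vs] set_vs by simp

lemma M_carrier: "M \<in> carrier_mat n n" by (rule laplacian_carrier)

lemma sum_vs: "(\<Sum>i<n. f (vs ! i)) = sum f (verts G)"
  by (rule sum.reindex_bij_betw) (use bij_betw_nth[OF distinct_vs refl set_vs[symmetric]] in simp)

lemma M_index: "i < n \<Longrightarrow> j < n \<Longrightarrow> M $$ (i, j) = L (vs ! i) (vs ! j)"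
  by (rule laplacian_index[OF distinct_vs])

lemma transpose_M: "transpose_mat M = M"
  using M_carrier by (intro eq_matI) (auto simp: M_index L_commute)

lemma mat_trace_M: "mat_trace M = degree_power_sum G 1"
  unfolding trace_L[symmetric] sum_vs[symmetric]
  using M_carrier by (simp add: mat_trace_def M_index)

lemma mat_trace_M2: "mat_trace (M * M) = degree_power_sum G 2 + degree_power_sum G 1"
  unfolding trace_L2[symmetric] sum_vs[symmetric]
  by (simp add: mat_trace_mult[OF M_carrier M_carrier] M_index)

lemma mat_trace_M3:
  "mat_trace (M * M * M) = degree_power_sum G 3 + 3 * degree_power_sum G 2 - 6 * net_triangles G \<sigma>"
proof -
  have MM: "M * M \<in> carrier_mat n n" using M_carrier by simp
  have "(M * M) $$ (i, j) = (\<Sum>k<n. M $$ (i, k) * M $$ (k, j))" if "i < n" "j < n" for i j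
    using M_carrier that by (simp add: scalar_prod_def atLeast0LessThan)
  then have "mat_trace (M * M * M) = (\<Sum>i<n. \<Sum>j<n. \<Sum>k<n. M $$ (i, k) * M $$ (k, j) * M $$ (j, i))"
    by (simp add: mat_trace_mult[OF MM M_carrier] sum_distrib_right)
  \<comment> \<open>The inner index \<open>k\<close> of \<open>M * M\<close> is the second vertex of
    the walk; the swap restores the order of summation of \<open>trace_L3\<close>.\<close>
  also have "\<dots> = (\<Sum>i<n. \<Sum>k<n. \<Sum>j<n. M $$ (i, k) * M $$ (k, j) * M $$ (j, i))"
    by (rule sum.cong[OF refl]) (rule sum.swap)
  finally show ?thesis
    unfolding trace_L3[symmetric] sum_vs[symmetric] by (simp add: M_index)
qed

text \<open>At an eigenvector, read as a function \<open>f\<close> on vertices, the quadratic form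
  is \<open>e\<close> times a positive sum of squares.\<close>

lemma eigenvalue_M_nonneg:
  assumes "eigenvalue M e"
  shows "0 \<le> e"
proof -
  from assms M_carrier obtain v where v: "v \<in> carrier_vec n" "v \<noteq> 0\<^sub>v n" and Mv: "M *\<^sub>v v = e \<cdot>\<^sub>v v"
    by (auto simp: eigenvalue_def eigenvector_def)
  define f where "f u = v $ (the_inv_into {..<n} ((!) vs) u)" for u
  have f: "f (vs ! i) = v $ i" if "i < n" for i
    using that distinct_vs by (simp add: f_def the_inv_into_f_f inj_on_nth)
  have row: "(\<Sum>j<n. M $$ (i, j) * v $ j) = e * v $ i" if "i < n" for i
    using arg_cong[OF Mv, of "\<lambda>w. w $ i"] M_carrier v that by (simp add: scalar_prod_def atLeast0LessThan)
  have "0 \<le> (\<Sum>u\<in>verts G. f u * (\<Sum>w\<in>verts G. L u w * f w))" by (rule quadratic_form_nonneg)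
  also have "\<dots> = (\<Sum>i<n. v $ i * (\<Sum>j<n. M $$ (i, j) * v $ j))"
    by (simp add: sum_vs[symmetric] f M_index)
  also have "\<dots> = (\<Sum>i<n. v $ i * (e * v $ i))" by (simp add: row)
  also have "\<dots> = e * (\<Sum>i<n. v $ i * v $ i)" by (simp add: sum_distrib_left mult_ac)
  finally have "0 \<le> e * (\<Sum>i<n. v $ i * v $ i)" .
  moreover have "(\<Sum>i<n. v $ i * v $ i) > 0"
  proof -
    obtain i where "i < n" "v $ i \<noteq> 0" using v by (metis eq_vecI carrier_vecD index_zero_vec)
    then show ?thesis by (intro sum_pos2[of _ i]) (auto simp: zero_less_mult_iff linorder_neq_iff)
  qed
  ultimately show ?thesis by (simp add: zero_le_mult_iff)
qed

lemma num_balanced_dvd_char_poly: "[:0, 1:] ^ num_balanced_components G \<sigma> dvd char_poly M"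
proof -
  obtain C :: "('a, 'b) pre_digraph set" and r x where C: "card C = num_balanced_components G \<sigma>"
    and inj: "inj_on r C" and r: "r ` C \<subseteq> verts G"
    and ker: "\<And>c u. c \<in> C \<Longrightarrow> u \<in> verts G \<Longrightarrow> (\<Sum>v\<in>verts G. L u v * x c v) = 0"
    and dual: "\<And>c c'. c \<in> C \<Longrightarrow> c' \<in> C \<Longrightarrow> x c (r c') = (if c = c' then 1 else 0 :: real)"
    by (rule num_balanced_kernel) (rule that)
  have bij: "bij_betw ((!) vs) {..<n} (verts G)"
    using bij_betw_nth[OF distinct_vs refl set_vs[symmetric]] .
  \<comment> \<open>\<open>p\<close> sends a vertex to its position in \<open>vs\<close>.\<close>
  define p where "p = the_inv_into {..<n} ((!) vs)"
  have p: "p v < n" "vs ! p v = v" if "v \<in> verts G" for v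
    using that bij the_inv_into_into[of "(!) vs" "{..<n}" v "{..<n}"] f_the_inv_into_f_bij_betw[OF bij]
    by (auto simp: p_def bij_betw_def)
  have "[:0, 1:] ^ card C dvd char_poly M"
  proof (rule kernel_vectors_dvd_char_poly[OF M_carrier, where r = "p \<circ> r" and x = "\<lambda>c i. x c (vs ! i)"])
    show "inj_on (p \<circ> r) C" using inj r p by (auto simp: inj_on_def) (metis image_subset_iff)
    show "(p \<circ> r) ` C \<subseteq> {..<n}" using r p by auto
    show "(\<Sum>j<n. M $$ (i, j) * x c (vs ! j)) = 0" if "c \<in> C" "i < n" for c i
    proof -
      have "vs ! i \<in> verts G" using that(2) set_vs nth_mem by blast
      from ker[OF that(1) this] show ?thesis
        unfolding sum_vs[symmetric] using that(2) by (simp add: M_index)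
    qed
    show "x c (vs ! (p \<circ> r) c') = (if c = c' then 1 else 0)" if "c \<in> C" "c' \<in> C" for c c'
      using dual[OF that] p(2)[of "r c'"] r that by auto
  qed
  then show ?thesis by (simp add: C)
qed

text \<open>Enough roots of the characteristic polynomial vanish to list the others among
  \<open>m\<close> entries; discarded or added zeros leave positive power sums unchanged.\<close>

lemma nonzero_eigenvalues:
  fixes m :: nat
  assumes m: "m = n - num_balanced_components G \<sigma>" and "0 < n"
  defines "M\<^sub>1 \<equiv> largest_eigenvalue M"
  obtains xs where "length xs = m" and "\<And>x. x \<in> set xs \<Longrightarrow> 0 \<le> x \<and> x \<le> M\<^sub>1" and "0 \<le> M\<^sub>1"
    and "(\<Sum>x\<leftarrow>xs. x ^ 1) = degree_power_sum G 1"
    and "(\<Sum>x\<leftarrow>xs. x ^ 2) = degree_power_sum G 2 + degree_power_sum G 1"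
    and "(\<Sum>x\<leftarrow>xs. x ^ 3) = degree_power_sum G 3 + 3 * degree_power_sum G 2 - 6 * net_triangles G \<sigma>"
proof -
  let ?b = "num_balanced_components G \<sigma>"
  obtain es where cp: "char_poly M = (\<Prod>e\<leftarrow>es. [:- e, 1:])" and es: "length es = n"
    using symmetric_char_poly_splits[OF M_carrier transpose_M] .
  have ev: "eigenvalue M e" if "e \<in> set es" for e
    using that by (auto simp: eigenvalue_root_char_poly[OF M_carrier] cp poly_prod_list prod_list_zero_iff)
  have bnd: "0 \<le> e \<and> e \<le> M\<^sub>1" if "e \<in> set es" for e
    unfolding M\<^sub>1_def largest_eigenvalue_def
    using ev[OF that] eigenvalue_M_nonneg card_finite_spectrum(1)[OF M_carrier]
    by (auto simp: spectrum_def intro!: Max_ge)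
  have "es \<noteq> []" using es \<open>0 < n\<close> by auto
  then have M0: "0 \<le> M\<^sub>1" using bnd[of "hd es"] by auto
  have count: "?b \<le> count_list es 0"
    using num_balanced_dvd_char_poly unfolding cp by (rule power_dvd_prod_linear_imp_count_le)
  define fs where "fs = filter (\<lambda>e. e \<noteq> 0) es"
  have "length fs + count_list es 0 = n"
    unfolding es[symmetric] fs_def by (induction es) auto
  then have fs: "length fs \<le> m" using count m by simp
  \<comment> \<open>Only \<open>length fs \<le> m\<close> has been shown, so zeros pad the list to
    the exact length \<open>m\<close>.\<close>
  define xs where "xs = fs @ replicate (m - length fs) 0"
  \<comment> \<open>Positivity of \<open>k\<close> matters because \<open>0 ^ 0 = 1\<close>.\<close>
  have pow: "(\<Sum>x\<leftarrow>xs. x ^ k) = mat_trace (M ^\<^sub>m k)" if "k > 0" for k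
  proof -
    have "(\<Sum>x\<leftarrow>xs. x ^ k) = (\<Sum>x\<leftarrow>fs. x ^ k)" using that by (simp add: xs_def sum_list_replicate)
    also have "\<dots> = (\<Sum>x\<leftarrow>es. x ^ k)"
      unfolding fs_def by (rule sum_list_map_filter) (use that in auto)
    finally show ?thesis using mat_trace_pow_eq_power_sum[OF M_carrier cp] by simp
  qed
  show thesis
  proof
    show "length xs = m" using fs by (simp add: xs_def)
    show "0 \<le> x \<and> x \<le> M\<^sub>1" if "x \<in> set xs" for x
      using that bnd M0 by (auto simp: xs_def fs_def split: if_splits)
    show "0 \<le> M\<^sub>1" by (rule M0)
    show "(\<Sum>x\<leftarrow>xs. x ^ 1) = degree_power_sum G 1"
      using pow[of 1] M_carrier mat_trace_M by simp
    show "(\<Sum>x\<leftarrow>xs. x ^ 2) = degree_power_sum G 2 + degree_power_sum G 1"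
      using pow[of 2] M_carrier mat_trace_M2 by (simp add: numeral_2_eq_2)
    show "(\<Sum>x\<leftarrow>xs. x ^ 3) = degree_power_sum G 3 + 3 * degree_power_sum G 2 - 6 * net_triangles G \<sigma>"
      using pow[of 3] M_carrier mat_trace_M3 by (simp add: numeral_3_eq_3)
  qed
qed

end

section \<open>The three bounds\<close>

theorem theorem3p3:
  fixes G :: "('a, 'b) pre_digraph" and \<sigma> :: "'a set \<Rightarrow> real" and vs :: "'a list"
    and n b :: nat and s :: "nat \<Rightarrow> real" and t :: real
  assumes "signed_graph G \<sigma>"
    and "distinct vs" and "set vs = verts G"
    and "n = card (verts G)"
    and "b = num_balanced_components G \<sigma>"
    and "s = degree_power_sum G"
    and "t = net_triangles G \<sigma>"
  shows
    "(b + 2 \<le> n \<longrightarrow>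
        largest_eigenvalue (laplacian G \<sigma> vs) \<ge>
          sqrt (((s 1)^2 - s 2 - s 1) / ((real n - real b) * (real n - real b - 1)))) \<and>
     (b + 3 \<le> n \<longrightarrow>
        largest_eigenvalue (laplacian G \<sigma> vs) \<ge>
          root 3 ((2 * s 3 + 6 * s 2 - 3 * s 2 * s 1 + (s 1)^3 - 3 * (s 1)^2 - 12 * t) /
            ((real n - real b) * (real n - real b - 1) * (real n - real b - 2)))) \<and>
     (b + 2 \<le> n \<longrightarrow>
        largest_eigenvalue (laplacian G \<sigma> vs) \<ge>
          root 3 (((s 1)^2 - 3 * s 2 + s 1 * s 2 - s 3 + 6 * t) /
            ((real n - real b) * (real n - real b - 1))))"
\<comment> \<open>Each of the three premises implies \<open>b + 2 \<le> n\<close>, so the other case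
  is vacuous.\<close>
proof (cases "b + 2 \<le> n")
  case True
  interpret enumerated_signed_graph G \<sigma> vs
    using assms(1-3) by (intro enumerated_signed_graph.intro enumerated_signed_graph_axioms.intro)
  let ?l = "largest_eigenvalue (laplacian G \<sigma> vs)"
  define m where "m = real n - real b"
  have n: "length vs = n" using length_vs assms(4) by simp
  have "n - b = length vs - num_balanced_components G \<sigma>" "0 < length vs"
    using n True assms(5) by simp_all
  then obtain xs where xs: "length xs = n - b" "\<And>x. x \<in> set xs \<Longrightarrow> 0 \<le> x \<and> x \<le> ?l" and lam: "0 \<le> ?l"
    and sums: "(\<Sum>x\<leftarrow>xs. x ^ 1) = degree_power_sum G 1"
      "(\<Sum>x\<leftarrow>xs. x ^ 2) = degree_power_sum G 2 + degree_power_sum G 1"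
      "(\<Sum>x\<leftarrow>xs. x ^ 3) = degree_power_sum G 3 + 3 * degree_power_sum G 2 - 6 * net_triangles G \<sigma>"
    by (rule nonzero_eigenvalues) (rule that)
  note p = sums[folded assms(6,7)]
  have lm: "real (length xs) = m" using xs(1) True by (simp add: m_def)
  note bounds = power_sums_le[of xs ?l, OF xs(2) lam, unfolded p lm]
  have m: "m \<ge> 2" using True by (simp add: m_def)
  have pos2: "0 < m * (m - 1)" using m by simp
  have "(s 1)\<^sup>2 - s 2 - s 1 \<le> m * (m - 1) * ?l\<^sup>2"
    using bounds(1) by simp
  then have "((s 1)\<^sup>2 - s 2 - s 1) / (m * (m - 1)) \<le> ?l\<^sup>2"
    using pos2 by (simp add: divide_le_eq mult.commute)
  then have 1: "sqrt (((s 1)\<^sup>2 - s 2 - s 1) / (m * (m - 1))) \<le> ?l"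
    using lam by (rule real_le_lsqrt[rotated])
  \<comment> \<open>\<open>root 3\<close> is monotone on all reals, so negative radicands are
    covered as well.\<close>
  have root: "root 3 y \<le> ?l" if "y \<le> ?l ^ 3" for y
    using real_root_le_mono[of 3 y "?l ^ 3"] that lam by (simp add: real_root_power_cancel)
  \<comment> \<open>This is \<open>p\<^sub>1\<^sup>3 - 3 p\<^sub>1 p\<^sub>2 + 2 p\<^sub>3\<close>
    expanded at \<open>p\<^sub>1 = s 1\<close>, \<open>p\<^sub>2 = s 2 + s 1\<close>,
    \<open>p\<^sub>3 = s 3 + 3 * s 2 - 6 * t\<close>.\<close>
  have "2 * s 3 + 6 * s 2 - 3 * s 2 * s 1 + (s 1)^3 - 3 * (s 1)\<^sup>2 - 12 * t \<le> m * (m - 1) * (m - 2) * ?l ^ 3"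
    using bounds(2) by (simp add: algebra_simps power2_eq_square)
  \<comment> \<open>At \<open>m = 2\<close> the denominator would vanish; \<open>m \<ge> 3\<close>
    makes it positive.\<close>
  then have 2: "root 3 ((2 * s 3 + 6 * s 2 - 3 * s 2 * s 1 + (s 1)^3 - 3 * (s 1)\<^sup>2 - 12 * t) /
      (m * (m - 1) * (m - 2))) \<le> ?l" if "m \<ge> 3"
    using that by (intro root) (simp add: divide_le_eq mult.commute)
  have "(s 1)\<^sup>2 - 3 * s 2 + s 1 * s 2 - s 3 + 6 * t \<le> m * (m - 1) * ?l ^ 3"
    using bounds(3) by (simp add: algebra_simps power2_eq_square)
  then have 3: "root 3 (((s 1)\<^sup>2 - 3 * s 2 + s 1 * s 2 - s 3 + 6 * t) / (m * (m - 1))) \<le> ?l"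
    using pos2 by (intro root) (simp add: divide_le_eq mult.commute)
  show ?thesis using 1 2 3 unfolding m_def by auto
qed auto

end
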